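(* Let $O=(W,t,A,S,\Delta,\Delta Y)\sim P_0$ be a generic observation with potential outcomes $S(a),Y(a)$, $a\in\{0,1\}$. Let $g_A(a\mid t)=P(A=a\mid t)$ be the treatment probability, known by design and depending on calendar time $t$ only, and let $\mathcal T_{\mathrm{ov}}=\{t:0<g_A(1\mid t)<1\}$. Assume: (1) Consistency: if $A=a$ then $S=S(a)$ and $Y=Y(a)$. (2) Sequential randomization: $(Y(0),Y(1),S(0),S(1))\perp A\mid W,t$. (3) Surrogate-mediated MAR: $P(\Delta=1\mid Y,S,A,W,t)=P(\Delta=1\mid S,A,W,t)$. (4) Support positivity: there is $c>0$ with $P(\Delta=1\mid S=s,A=a,W=w,t)\ge c$ on the relevant support. (5) Treatment overlap: there is $\eta>0$ such that $\eta\le g_A(1\mid t)\le 1-\eta$ for all $t\in\mathcal T_{\mathrm{ov}}$. Then the overlap-support average treatment effect $\Psi(P_0):=\mathbb E[Y(1)-Y(0)\mid t\in\mathcal T_{\mathrm{ov}}]$ is identified by $$\Psi(P_0)=\frac{1}{P(t\in\mathcal T_{\mathrm{ov}})}\,\mathbb E_{W,t}\Bigl(\mathbf 1\{t\in\mathcal T_{\mathrm{ov}}\}\Bigl[\mathbb E_{S\mid A=1,W,t}\bigl[\mathbb E[Y\mid S,A=1,W,t,\Delta=1]\bigr]-\mathbb E_{S\mid A=0,W,t}\bigl[\mathbb E[Y\mid S,A=0,W,t,\Delta=1]\bigr]\Bigr]\Bigr).$$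
   Context: $W\in\mathbb R^p$ are baseline covariates; $t\in\{1,\dots,T\}$ is the calendar period, treated as part of the random observation; $A\in\{0,1\}$ is treatment; $S$ is a short-term surrogate, always observed; $\Delta\in\{0,1\}$ indicates whether the delayed primary outcome $Y$ is observed by the administrative end date. Only the product $\Delta Y$ is recorded. $\mathbb E_{W,t}$ is expectation over the marginal law of $(W,t)$, and $\mathbb E_{S\mid A=a,W,t}$ is expectation over the conditional law of $S$ given $A=a,W,t$. The conditional probability of treatment given $(W,t)$ equals $g_A(\cdot\mid t)$ (randomization by design). In the main example (a stepped-wedge cluster-randomized trial with crossover time uniform on $\{2,\dots,T\}$), $g_A(1\mid t)=(t-1)/(T-1)$ and $\mathcal T_{\mathrm{ov}}=\{2,\dots,T-1\}$. *)

theory Defs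
  imports "HOL-Probability.Probability"
begin

text \<open>Conditioning on a random element \<open>X\<close> with values in \<open>N\<close>: \<open>E[f | X]\<close> and \<open>P(E | X)\<close> are
  the library's conditional expectation with respect to the sigma-algebra generated by \<open>X\<close>.\<close>

definition cexp_given ::
    "'a measure \<Rightarrow> 'b measure \<Rightarrow> ('a \<Rightarrow> 'b) \<Rightarrow> ('a \<Rightarrow> real) \<Rightarrow> 'a \<Rightarrow> real" where
  "cexp_given M N X f = real_cond_exp M (vimage_algebra (space M) X N) f"

definition cprob_given ::
    "'a measure \<Rightarrow> 'b measure \<Rightarrow> ('a \<Rightarrow> 'b) \<Rightarrow> ('a \<Rightarrow> bool) \<Rightarrow> 'a \<Rightarrow> real" where
  "cprob_given M N X P = cexp_given M N X (indicator {\<omega> \<in> space M. P \<omega>})"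

text \<open>\<open>q\<close> is a version of the regression function \<open>x \<mapsto> E[f | X = x]\<close>.\<close>

definition is_regression ::
    "'a measure \<Rightarrow> 'b measure \<Rightarrow> ('a \<Rightarrow> 'b) \<Rightarrow> ('a \<Rightarrow> real) \<Rightarrow> ('b \<Rightarrow> real) \<Rightarrow> bool" where
  "is_regression M N X f q \<longleftrightarrow>
     q \<in> borel_measurable N \<and> (AE \<omega> in M. q (X \<omega>) = cexp_given M N X f \<omega>)"

text \<open>\<open>K\<close> is a version of the (regular) conditional law \<open>x \<mapsto> Law(V | X = x)\<close>.  Such a
  kernel always exists when the target \<open>L\<close> is the Borel space of a Polish space.\<close>

definition is_cond_law ::
    "'a measure \<Rightarrow> 'b measure \<Rightarrow> ('a \<Rightarrow> 'b) \<Rightarrow> 'c measure \<Rightarrow> ('a \<Rightarrow> 'c) \<Rightarrow> ('b \<Rightarrow> 'c measure) \<Rightarrow> bool" where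
  "is_cond_law M N X L V K \<longleftrightarrow>
     K \<in> N \<rightarrow>\<^sub>M prob_algebra L \<and>
     (\<forall>B \<in> sets L. AE \<omega> in M. measure (K (X \<omega>)) B = cprob_given M N X (\<lambda>\<omega>. V \<omega> \<in> B) \<omega>)"

definition cond_indep ::
    "'a measure \<Rightarrow> 'b measure \<Rightarrow> ('a \<Rightarrow> 'b) \<Rightarrow> 'c measure \<Rightarrow> ('a \<Rightarrow> 'c) \<Rightarrow> 'd measure \<Rightarrow> ('a \<Rightarrow> 'd) \<Rightarrow> bool" where
  "cond_indep M N1 U N2 V N X \<longleftrightarrow>
     (\<forall>B \<in> sets N1. \<forall>C \<in> sets N2. AE \<omega> in M.
        cprob_given M N X (\<lambda>\<omega>. U \<omega> \<in> B \<and> V \<omega> \<in> C) \<omega> =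
        cprob_given M N X (\<lambda>\<omega>. U \<omega> \<in> B) \<omega> * cprob_given M N X (\<lambda>\<omega>. V \<omega> \<in> C) \<omega>)"

text \<open>\<open>g\<^sub>A(a | k) = P(A = a | t = k)\<close>.  By the convention \<open>x / 0 = 0\<close> it vanishes for periods
  of probability zero, so the overlap set contains only periods that occur with positive
  probability.\<close>

definition treat_prob :: "'a measure \<Rightarrow> ('a \<Rightarrow> nat) \<Rightarrow> ('a \<Rightarrow> nat) \<Rightarrow> nat \<Rightarrow> nat \<Rightarrow> real" where
  "treat_prob M A t a k = cond_prob M (\<lambda>\<omega>. A \<omega> = a) (\<lambda>\<omega>. t \<omega> = k)"

definition overlap :: "'a measure \<Rightarrow> ('a \<Rightarrow> nat) \<Rightarrow> ('a \<Rightarrow> nat) \<Rightarrow> nat set" where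
  "overlap M A t = {k. 0 < treat_prob M A t 1 k \<and> treat_prob M A t 1 k < 1}"

text \<open>The estimand \<open>E[Y(1) - Y(0) | t \<in> T\<^sub>o\<^sub>v]\<close>, as expectation under \<open>P( \<cdot> | t \<in> T\<^sub>o\<^sub>v)\<close>;
  it is \<open>0\<close> by convention if the overlap set is empty.\<close>

definition overlap_ate ::
    "'a measure \<Rightarrow> ('a \<Rightarrow> nat) \<Rightarrow> ('a \<Rightarrow> nat) \<Rightarrow> (nat \<Rightarrow> 'a \<Rightarrow> real) \<Rightarrow> real" where
  "overlap_ate M A t Yp =
     (\<integral>\<omega>. Yp 1 \<omega> - Yp 0 \<omega> \<partial>uniform_measure M {\<omega> \<in> space M. t \<omega> \<in> overlap M A t})"

end

theory Submission
  imports Defs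
begin

text \<open>All identities are proved in weak form, tested against the bounded weight
  \<open>\<psi> = 1{t \<in> T\<^sub>o\<^sub>v} 1{A = a} / g\<^sub>A(a | t)\<close>.  Randomization and consistency give
  \<open>E[1{t \<in> T\<^sub>o\<^sub>v} Y(a)] = E[\<psi> Y(a)] = E[\<psi> Y]\<close>; the missing-at-random assumption replaces \<open>Y\<close> by
  \<open>q = E[Y | S, A, W, t, \<Delta> = 1]\<close>; disintegration of \<open>S\<close> along \<open>(A, W, t)\<close> replaces \<open>q\<close> by its
  conditional mean \<open>h\<^sub>a(W, t)\<close> given \<open>A = a, W, t\<close>; and \<open>P(A = a | W, t) = g\<^sub>A(a | t)\<close> removes the
  weight again, leaving \<open>E[1{t \<in> T\<^sub>o\<^sub>v} h\<^sub>a(W, t)]\<close>.  Each step also carries integrability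
  along, which for \<open>h\<^sub>a\<close> is available only on the overlap set.\<close>

lemma subalgebra_vimage_algebra:
  assumes "X \<in> M \<rightarrow>\<^sub>M N"
  shows "subalgebra M (vimage_algebra (space M) X N)"
  using assms sets_image_in_sets[of M "space M" X N] by (auto simp: subalgebra_def)

lemma measurable_vimage_algebra_comp:
  assumes "X \<in> M \<rightarrow>\<^sub>M N" "f \<in> N \<rightarrow>\<^sub>M L"
  shows "(\<lambda>\<omega>. f (X \<omega>)) \<in> vimage_algebra (space M) X N \<rightarrow>\<^sub>M L"
  using assms by (intro measurable_compose[OF measurable_vimage_algebra1]) (auto dest: measurable_space)

lemma subalgebra_vimage_algebra_comp:
  assumes "X \<in> M \<rightarrow>\<^sub>M N" "f \<in> N \<rightarrow>\<^sub>M L"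
  shows "subalgebra (vimage_algebra (space M) X N) (vimage_algebra (space M) (\<lambda>\<omega>. f (X \<omega>)) L)"
  using measurable_vimage_algebra_comp[OF assms]
    sets_image_in_sets[of "vimage_algebra (space M) X N" "space M" "\<lambda>\<omega>. f (X \<omega>)" L]
  by (auto simp: subalgebra_def)

lemma (in finite_measure) sigma_finite_subalgebraI:
  "subalgebra M F \<Longrightarrow> sigma_finite_subalgebra M F"
  by (intro finite_measure_subalgebra_is_sigma_finite)
    (simp add: finite_measure_subalgebra_def finite_measure_subalgebra_axioms_def finite_measure_axioms)

lemma integrable_bounded_mult:
  fixes f g :: "'a \<Rightarrow> real"
  assumes "integrable M f" "g \<in> borel_measurable M" "AE x in M. \<bar>g x\<bar> \<le> b"
  shows "integrable M (\<lambda>x. g x * f x)"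
proof (rule Bochner_Integration.integrable_bound[of M "\<lambda>x. b * f x"])
  show "AE x in M. norm (g x * f x) \<le> norm (b * f x)"
    using assms(3) by eventually_elim (auto simp: abs_mult intro!: mult_right_mono)
qed (use assms in auto)

text \<open>\<open>F\<close>, \<open>G\<close>, \<open>H\<close> stand for the information in \<open>X\<close>, \<open>(Y, X)\<close> and \<open>(X, 1\<^sub>E)\<close>, where \<open>E\<close> is the event that
  \<open>Y\<close> is observed, and \<open>q1\<close> is the regression of \<open>Y\<close> among the observed.  The proof inserts the
  inverse probability weight \<open>\<rho> = \<psi> / P(E | F)\<close>.\<close>

lemma (in finite_measure) missing_at_random_integral:
  fixes Y q1 \<psi> :: "'a \<Rightarrow> real" and E :: "'a set" and F :: "'a measure"
  defines "p \<equiv> real_cond_exp M F (indicator E)"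
  assumes F: "subalgebra G F" "subalgebra H F" and G: "subalgebra M G" and H: "subalgebra M H"
    and E: "E \<in> sets H" and Y: "Y \<in> borel_measurable G" "integrable M Y"
    and MAR: "AE \<omega> in M. real_cond_exp M G (indicator E) \<omega> = p \<omega>"
    and q1: "q1 \<in> borel_measurable F" "AE \<omega> in M. \<omega> \<in> E \<longrightarrow> q1 \<omega> = real_cond_exp M H Y \<omega>"
    and \<psi>: "\<psi> \<in> borel_measurable F" "AE \<omega> in M. \<bar>\<psi> \<omega>\<bar> \<le> b"
    and pos: "c > 0" "AE \<omega> in M. \<psi> \<omega> \<noteq> 0 \<longrightarrow> c \<le> p \<omega>"
  shows "integrable M (\<lambda>\<omega>. \<psi> \<omega> * q1 \<omega>)" "(\<integral>\<omega>. \<psi> \<omega> * q1 \<omega> \<partial>M) = (\<integral>\<omega>. \<psi> \<omega> * Y \<omega> \<partial>M)"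
proof -
  have FM: "subalgebra M F" using F G by (auto simp: subalgebra_def)
  interpret F: sigma_finite_subalgebra M F by (rule sigma_finite_subalgebraI[OF FM])
  interpret G: sigma_finite_subalgebra M G by (rule sigma_finite_subalgebraI[OF G])
  interpret H: sigma_finite_subalgebra M H by (rule sigma_finite_subalgebraI[OF H])
  have [measurable]: "E \<in> sets M" using E H by (auto simp: subalgebra_def)
  have p[measurable]: "p \<in> borel_measurable F" unfolding p_def by simp
  have [measurable]: "\<psi> \<in> borel_measurable F" "q1 \<in> borel_measurable F" by fact+
  define \<rho> where "\<rho> = (\<lambda>\<omega>. if c \<le> p \<omega> then \<psi> \<omega> / p \<omega> else 0)"
  have \<rho>F[measurable]: "\<rho> \<in> borel_measurable F" unfolding \<rho>_def by measurable
  have \<rho>G[measurable]: "\<rho> \<in> borel_measurable G" and \<rho>H: "\<rho> \<in> borel_measurable H"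
    using \<rho>F F by (auto intro: measurable_from_subalg)
  have [measurable]: "(indicator E :: 'a \<Rightarrow> real) \<in> borel_measurable H" using E by simp
  have YM[measurable]: "Y \<in> borel_measurable M" using Y by auto
  have toM: "f \<in> borel_measurable F \<Longrightarrow> f \<in> borel_measurable M" for f :: "'a \<Rightarrow> real"
    by (rule measurable_from_subalg[OF FM])
  have [measurable]: "\<rho> \<in> borel_measurable M" "\<psi> \<in> borel_measurable M" "q1 \<in> borel_measurable M"
    "p \<in> borel_measurable M" by (auto intro: toM)
  have \<psi>\<rho>: "AE \<omega> in M. \<rho> \<omega> * p \<omega> = \<psi> \<omega>"
    using pos(2) by eventually_elim (use pos(1) in \<open>auto simp: \<rho>_def\<close>)
  have \<rho>b: "AE \<omega> in M. \<bar>\<rho> \<omega>\<bar> \<le> b / c"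
    using \<psi>(2)
  proof eventually_elim
    case (elim \<omega>)
    then have "0 \<le> b" by linarith
    with elim pos(1) show ?case
      by (auto simp: \<rho>_def abs_mult intro!: frac_le)
  qed
  have iY: "integrable M (\<lambda>\<omega>. \<rho> \<omega> * indicator E \<omega> * Y \<omega>)"
  proof (rule integrable_bounded_mult[OF Y(2)])
    show "AE \<omega> in M. \<bar>\<rho> \<omega> * indicator E \<omega>\<bar> \<le> b / c"
      using \<rho>b by eventually_elim (auto simp: indicator_def intro: order_trans[OF abs_ge_zero])
  qed measurable
  have \<rho>H_E: "(\<lambda>\<omega>. \<rho> \<omega> * indicator E \<omega>) \<in> borel_measurable H" using \<rho>H by measurable
  note h = H.real_cond_exp_intg[OF iY \<rho>H_E YM]
  have heq: "AE \<omega> in M. \<rho> \<omega> * indicator E \<omega> * real_cond_exp M H Y \<omega> = \<rho> \<omega> * q1 \<omega> * indicator E \<omega>"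
    using q1(2) by eventually_elim (auto simp: indicator_def)
  have iq: "integrable M (\<lambda>\<omega>. \<rho> \<omega> * q1 \<omega> * indicator E \<omega>)"
    by (subst integrable_cong_AE[OF _ _ heq, symmetric]) (use h in auto)
  have q\<rho>: "(\<lambda>\<omega>. \<rho> \<omega> * q1 \<omega>) \<in> borel_measurable F" by measurable
  have iEM: "(indicator E :: 'a \<Rightarrow> real) \<in> borel_measurable M" by measurable
  note f = F.real_cond_exp_intg[OF iq q\<rho> iEM, folded p_def]
  have feq: "AE \<omega> in M. \<rho> \<omega> * q1 \<omega> * p \<omega> = \<psi> \<omega> * q1 \<omega>"
    using \<psi>\<rho> by eventually_elim (simp add: mult_ac flip: mult.assoc)
  show "integrable M (\<lambda>\<omega>. \<psi> \<omega> * q1 \<omega>)"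
    by (subst integrable_cong_AE[OF _ _ feq, symmetric]) (use f in auto)
  have iY': "integrable M (\<lambda>\<omega>. \<rho> \<omega> * Y \<omega> * indicator E \<omega>)"
    using iY by (simp add: mult_ac)
  have Y\<rho>: "(\<lambda>\<omega>. \<rho> \<omega> * Y \<omega>) \<in> borel_measurable G" using Y(1) by measurable
  note g = G.real_cond_exp_intg[OF iY' Y\<rho> iEM]
  have geq: "AE \<omega> in M. \<rho> \<omega> * Y \<omega> * real_cond_exp M G (indicator E) \<omega> = \<psi> \<omega> * Y \<omega>"
    using \<psi>\<rho> MAR by eventually_elim (simp add: mult_ac flip: mult.assoc)
  have "(\<integral>\<omega>. \<psi> \<omega> * q1 \<omega> \<partial>M) = (\<integral>\<omega>. \<rho> \<omega> * q1 \<omega> * p \<omega> \<partial>M)"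
    by (rule integral_cong_AE) (use feq in \<open>auto elim: eventually_mono\<close>)
  also have "\<dots> = (\<integral>\<omega>. \<rho> \<omega> * q1 \<omega> * indicator E \<omega> \<partial>M)" by (rule f(2))
  also have "\<dots> = (\<integral>\<omega>. \<rho> \<omega> * indicator E \<omega> * real_cond_exp M H Y \<omega> \<partial>M)"
    by (rule integral_cong_AE) (use heq in \<open>auto elim: eventually_mono\<close>)
  also have "\<dots> = (\<integral>\<omega>. \<rho> \<omega> * indicator E \<omega> * Y \<omega> \<partial>M)" by (rule h(2))
  also have "\<dots> = (\<integral>\<omega>. \<rho> \<omega> * Y \<omega> * indicator E \<omega> \<partial>M)" by (simp add: mult_ac)
  also have "\<dots> = (\<integral>\<omega>. \<rho> \<omega> * Y \<omega> * real_cond_exp M G (indicator E) \<omega> \<partial>M)" by (rule g(2)[symmetric])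
  also have "\<dots> = (\<integral>\<omega>. \<psi> \<omega> * Y \<omega> \<partial>M)"
    by (rule integral_cong_AE) (use geq in auto)
  finally show "(\<integral>\<omega>. \<psi> \<omega> * q1 \<omega> \<partial>M) = (\<integral>\<omega>. \<psi> \<omega> * Y \<omega> \<partial>M)" .
qed

lemma (in finite_measure) cond_indep_integral:
  fixes f :: "'b \<Rightarrow> real" and \<phi> :: "'a \<Rightarrow> real"
  assumes indep: "cond_indep M N1 U N2 V N X"
    and U[measurable]: "U \<in> M \<rightarrow>\<^sub>M N1" and V[measurable]: "V \<in> M \<rightarrow>\<^sub>M N2" and X: "X \<in> M \<rightarrow>\<^sub>M N"
    and C[measurable]: "C \<in> sets N2" and f[measurable]: "f \<in> borel_measurable N1"
    and \<phi>: "\<phi> \<in> borel_measurable (vimage_algebra (space M) X N)"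
      "\<And>\<omega>. 0 \<le> \<phi> \<omega>" "\<And>\<omega>. \<phi> \<omega> \<le> b"
  shows "(\<integral>\<omega>. \<phi> \<omega> * indicator C (V \<omega>) * f (U \<omega>) \<partial>M) =
    (\<integral>\<omega>. \<phi> \<omega> * cprob_given M N X (\<lambda>\<omega>. V \<omega> \<in> C) \<omega> * f (U \<omega>) \<partial>M)"
proof -
  define F where "F = vimage_algebra (space M) X N"
  have FM: "subalgebra M F" unfolding F_def by (rule subalgebra_vimage_algebra[OF X])
  interpret F: sigma_finite_subalgebra M F by (rule sigma_finite_subalgebraI[OF FM])
  define p where "p = cprob_given M N X (\<lambda>\<omega>. V \<omega> \<in> C)"
  have p_eq: "p = real_cond_exp M F (indicator {\<omega>\<in>space M. V \<omega> \<in> C})"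
    by (simp add: p_def cprob_given_def cexp_given_def F_def)
  have \<phi>F[measurable]: "\<phi> \<in> borel_measurable F" using \<phi> by (simp add: F_def)
  have pF[measurable]: "p \<in> borel_measurable F" unfolding p_eq by simp
  have [measurable]: "\<phi> \<in> borel_measurable M" "p \<in> borel_measurable M"
    by (auto intro: measurable_from_subalg[OF FM])
  have p0: "AE \<omega> in M. 0 \<le> p \<omega>" unfolding p_eq by (rule F.real_cond_exp_pos) auto
  have ip: "integrable M p" unfolding p_eq
    by (intro F.real_cond_exp_int) (simp add: integrable_real_indicator emeasure_eq_measure)
  have bd: "\<bar>\<phi> \<omega>\<bar> \<le> b" for \<omega> using \<phi>(2,3)[of \<omega>] by simp
  let ?\<nu>1 = "distr (density M (\<lambda>\<omega>. \<phi> \<omega> * indicator C (V \<omega>))) N1 U"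
  let ?\<nu>2 = "distr (density M (\<lambda>\<omega>. \<phi> \<omega> * p \<omega>)) N1 U"
  have "?\<nu>1 = ?\<nu>2"
  proof (rule measure_eqI)
    fix B assume "B \<in> sets ?\<nu>1"
    then have B[measurable]: "B \<in> sets N1" by simp
    let ?B = "{\<omega>\<in>space M. U \<omega> \<in> B}" and ?BC = "{\<omega>\<in>space M. U \<omega> \<in> B \<and> V \<omega> \<in> C}"
    have ib: "integrable M (indicator {\<omega>\<in>space M. P \<omega>} :: 'a \<Rightarrow> real)" if "{\<omega>\<in>space M. P \<omega>} \<in> sets M" for P
      using that by (simp add: integrable_real_indicator emeasure_eq_measure)
    have i1: "integrable M (\<lambda>\<omega>. \<phi> \<omega> * indicator ?BC \<omega>)"
      by (rule integrable_bounded_mult[OF ib]) (use bd in auto)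
    have i2: "integrable M (\<lambda>\<omega>. \<phi> \<omega> * p \<omega> * indicator ?B \<omega>)"
    proof -
      have "integrable M (\<lambda>\<omega>. \<phi> \<omega> * indicator ?B \<omega> * p \<omega>)"
        by (rule integrable_bounded_mult[OF ip, of _ b]) (use bd order_trans[OF \<phi>(2,3)] in \<open>auto simp: indicator_def\<close>)
      then show ?thesis by (simp add: mult_ac)
    qed
    have mBC: "(indicator ?BC :: 'a \<Rightarrow> real) \<in> borel_measurable M"
      and mB: "(indicator ?B :: 'a \<Rightarrow> real) \<in> borel_measurable M" by measurable
    have \<phi>p: "(\<lambda>\<omega>. \<phi> \<omega> * p \<omega>) \<in> borel_measurable F" by measurable
    have "(\<integral>\<omega>. \<phi> \<omega> * indicator ?BC \<omega> \<partial>M) = (\<integral>\<omega>. \<phi> \<omega> * real_cond_exp M F (indicator ?BC) \<omega> \<partial>M)"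
      by (rule F.real_cond_exp_intg(2)[OF i1 \<phi>F mBC, symmetric])
    also have "\<dots> = (\<integral>\<omega>. \<phi> \<omega> * p \<omega> * real_cond_exp M F (indicator ?B) \<omega> \<partial>M)"
    proof (rule integral_cong_AE)
      have "AE \<omega> in M. real_cond_exp M F (indicator ?BC) \<omega> = real_cond_exp M F (indicator ?B) \<omega> * p \<omega>"
        using indep B C unfolding cond_indep_def cprob_given_def cexp_given_def p_eq F_def by blast
      then show "AE \<omega> in M. \<phi> \<omega> * real_cond_exp M F (indicator ?BC) \<omega> =
          \<phi> \<omega> * p \<omega> * real_cond_exp M F (indicator ?B) \<omega>"
        by eventually_elim simp
    qed auto
    also have "\<dots> = (\<integral>\<omega>. \<phi> \<omega> * p \<omega> * indicator ?B \<omega> \<partial>M)"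
      by (rule F.real_cond_exp_intg(2)[OF i2 \<phi>p mB])
    finally have eq: "(\<integral>\<omega>. \<phi> \<omega> * indicator ?BC \<omega> \<partial>M) = (\<integral>\<omega>. \<phi> \<omega> * p \<omega> * indicator ?B \<omega> \<partial>M)" .
    have "emeasure ?\<nu>1 B = (\<integral>\<^sup>+\<omega>. ennreal (\<phi> \<omega> * indicator ?BC \<omega>) \<partial>M)"
      by (simp add: emeasure_distr emeasure_density) (auto intro!: nn_integral_cong simp: indicator_def)
    also have "\<dots> = ennreal (\<integral>\<omega>. \<phi> \<omega> * indicator ?BC \<omega> \<partial>M)"
      by (rule nn_integral_eq_integral[OF i1]) (simp add: \<phi>(2))
    also have "\<dots> = ennreal (\<integral>\<omega>. \<phi> \<omega> * p \<omega> * indicator ?B \<omega> \<partial>M)"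
      by (simp only: eq)
    also have "\<dots> = (\<integral>\<^sup>+\<omega>. ennreal (\<phi> \<omega> * p \<omega> * indicator ?B \<omega>) \<partial>M)"
    proof (rule nn_integral_eq_integral[OF i2, symmetric])
      show "AE \<omega> in M. 0 \<le> \<phi> \<omega> * p \<omega> * indicator ?B \<omega>"
        using p0 by eventually_elim (simp add: \<phi>(2))
    qed
    also have "\<dots> = emeasure ?\<nu>2 B"
      by (simp add: emeasure_distr emeasure_density) (auto intro!: nn_integral_cong simp: indicator_def)
    finally show "emeasure ?\<nu>1 B = emeasure ?\<nu>2 B" .
  qed simp
  then have "integral\<^sup>L ?\<nu>1 f = integral\<^sup>L ?\<nu>2 f" by simp
  moreover have "integral\<^sup>L ?\<nu>1 f = (\<integral>\<omega>. \<phi> \<omega> * indicator C (V \<omega>) * f (U \<omega>) \<partial>M)"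
    using \<phi>(2) by (simp add: integral_distr integral_density)
  moreover have "integral\<^sup>L ?\<nu>2 f = (\<integral>\<omega>. \<phi> \<omega> * p \<omega> * f (U \<omega>) \<partial>M)"
  proof -
    have "AE \<omega> in M. 0 \<le> \<phi> \<omega> * p \<omega>" using p0 by eventually_elim (simp add: \<phi>(2))
    then show ?thesis by (simp add: integral_distr integral_density)
  qed
  ultimately show ?thesis by (simp add: p_def)
qed

lemma (in prob_space) cond_law_nn_integral:
  assumes K: "is_cond_law M N X L V K"
    and X[measurable]: "X \<in> M \<rightarrow>\<^sub>M N" and V[measurable]: "V \<in> M \<rightarrow>\<^sub>M L"
    and f[measurable]: "f \<in> borel_measurable (N \<Otimes>\<^sub>M L)"
  shows "(\<integral>\<^sup>+\<omega>. f (X \<omega>, V \<omega>) \<partial>M) = (\<integral>\<^sup>+\<omega>. \<integral>\<^sup>+s. f (X \<omega>, s) \<partial>K (X \<omega>) \<partial>M)"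
proof -
  define F where "F = vimage_algebra (space M) X N"
  have FM: "subalgebra M F" unfolding F_def by (rule subalgebra_vimage_algebra[OF X])
  interpret F: sigma_finite_subalgebra M F by (rule sigma_finite_subalgebraI[OF FM])
  have Kp: "K \<in> N \<rightarrow>\<^sub>M prob_algebra L" using K by (simp add: is_cond_law_def)
  then have Ks[measurable]: "K \<in> N \<rightarrow>\<^sub>M subprob_algebra L" by (rule measurable_prob_algebraD)
  have prob: "prob_space (K x)" if "x \<in> space N" for x
    using measurable_space[OF Kp that] by (simp add: space_prob_algebra)
  have KX[measurable]: "(\<lambda>\<omega>. K (X \<omega>)) \<in> M \<rightarrow>\<^sub>M subprob_algebra L" by measurable
  have setsK[simp]: "sets (K (X \<omega>)) = sets L" if "\<omega> \<in> space M" for \<omega>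
    using that by (rule sets_kernel[OF KX])
  define J where "J = (\<lambda>\<omega>. distr (K (X \<omega>)) (N \<Otimes>\<^sub>M L) (\<lambda>s. (X \<omega>, s)))"
  have J[measurable]: "J \<in> M \<rightarrow>\<^sub>M subprob_algebra (N \<Otimes>\<^sub>M L)"
    unfolding J_def by (rule measurable_distr2[where M=L]) measurable
  let ?\<nu> = "distr M (N \<Otimes>\<^sub>M L) (\<lambda>\<omega>. (X \<omega>, V \<omega>))"
  have pair: "(\<lambda>s. (X \<omega>, s)) \<in> K (X \<omega>) \<rightarrow>\<^sub>M N \<Otimes>\<^sub>M L" if "\<omega> \<in> space M" for \<omega>
    using that measurable_space[OF X that] by (simp cong: measurable_cong_sets)
  have "?\<nu> = M \<bind> J"
  proof (rule measure_eqI_generator_eq[OF Int_stable_pair_measure_generator pair_measure_closed])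
    fix R assume "R \<in> {a \<times> b |a b. a \<in> sets N \<and> b \<in> sets L}"
    then obtain C B where R: "R = C \<times> B" and [measurable]: "C \<in> sets N" "B \<in> sets L" by auto
    let ?p = "real_cond_exp M F (indicator {\<omega>\<in>space M. V \<omega> \<in> B})"
    have Kp: "AE \<omega> in M. measure (K (X \<omega>)) B = ?p \<omega>"
      using K \<open>B \<in> sets L\<close> unfolding is_cond_law_def cprob_given_def cexp_given_def F_def by blast
    have iCB: "integrable M (\<lambda>\<omega>. indicator C (X \<omega>) * indicator {\<omega>\<in>space M. V \<omega> \<in> B} \<omega> :: real)"
      by (rule integrable_bounded_mult[where b=1])
        (auto simp: integrable_real_indicator emeasure_eq_measure)
    have CF: "(\<lambda>\<omega>. indicator C (X \<omega>) :: real) \<in> borel_measurable F"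
      unfolding F_def by (rule measurable_vimage_algebra_comp[OF X]) measurable
    have BM: "(indicator {\<omega>\<in>space M. V \<omega> \<in> B} :: 'a \<Rightarrow> real) \<in> borel_measurable M" by measurable
    note c = F.real_cond_exp_intg[OF iCB CF BM]
    have ae: "AE \<omega> in M. indicator C (X \<omega>) * ?p \<omega> = indicator C (X \<omega>) * measure (K (X \<omega>)) B"
      using Kp by eventually_elim simp
    have iK: "integrable M (\<lambda>\<omega>. indicator C (X \<omega>) * measure (K (X \<omega>)) B)"
      by (subst integrable_cong_AE[OF _ _ ae, symmetric]) (use c in auto)
    have "emeasure ?\<nu> R = (\<integral>\<^sup>+\<omega>. indicator R (X \<omega>, V \<omega>) \<partial>M)"
      unfolding R by (subst nn_integral_indicator[symmetric], simp, subst nn_integral_distr) auto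
    also have "\<dots> = (\<integral>\<^sup>+\<omega>. ennreal (indicator C (X \<omega>) * indicator {\<omega>\<in>space M. V \<omega> \<in> B} \<omega>) \<partial>M)"
      by (auto intro!: nn_integral_cong simp: R indicator_def)
    also have "\<dots> = ennreal (\<integral>\<omega>. indicator C (X \<omega>) * indicator {\<omega>\<in>space M. V \<omega> \<in> B} \<omega> \<partial>M)"
      by (rule nn_integral_eq_integral[OF iCB]) simp
    also have "\<dots> = ennreal (\<integral>\<omega>. indicator C (X \<omega>) * ?p \<omega> \<partial>M)"
      by (simp only: c(2))
    also have "\<dots> = ennreal (\<integral>\<omega>. indicator C (X \<omega>) * measure (K (X \<omega>)) B \<partial>M)"
      by (rule arg_cong[of _ _ ennreal], rule integral_cong_AE) (use ae in auto)
    also have "\<dots> = (\<integral>\<^sup>+\<omega>. ennreal (indicator C (X \<omega>) * measure (K (X \<omega>)) B) \<partial>M)"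
      by (rule nn_integral_eq_integral[OF iK, symmetric]) simp
    also have "\<dots> = (\<integral>\<^sup>+\<omega>. emeasure (J \<omega>) R \<partial>M)"
    proof (rule nn_integral_cong)
      fix \<omega> assume \<omega>: "\<omega> \<in> space M"
      interpret K: prob_space "K (X \<omega>)" by (rule prob[OF measurable_space[OF X \<omega>]])
      have sp: "space (K (X \<omega>)) = space L" using setsK[OF \<omega>] by (rule sets_eq_imp_space_eq)
      have "emeasure (J \<omega>) R = emeasure (K (X \<omega>)) ((\<lambda>s. (X \<omega>, s)) -` R \<inter> space (K (X \<omega>)))"
        unfolding J_def R by (rule emeasure_distr[OF pair[OF \<omega>]]) auto
      also have "(\<lambda>s. (X \<omega>, s)) -` R \<inter> space (K (X \<omega>)) = (if X \<omega> \<in> C then B else {})"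
        using sets.sets_into_space[OF \<open>B \<in> sets L\<close>] by (auto simp: R sp)
      finally show "ennreal (indicator C (X \<omega>) * measure (K (X \<omega>)) B) = emeasure (J \<omega>) R"
        by (simp add: K.emeasure_eq_measure)
    qed
    also have "\<dots> = emeasure (M \<bind> J) R"
      unfolding R by (rule emeasure_bind[OF not_empty J, symmetric]) auto
    finally show "emeasure ?\<nu> R = emeasure (M \<bind> J) R" .
  next
    show "sets ?\<nu> = sigma_sets (space N \<times> space L) {a \<times> b |a b. a \<in> sets N \<and> b \<in> sets L}"
      by (simp add: sets_pair_measure)
    show "sets (M \<bind> J) = sigma_sets (space N \<times> space L) {a \<times> b |a b. a \<in> sets N \<and> b \<in> sets L}"
      by (subst sets_bind[OF sets_kernel[OF J] not_empty]) (auto simp: sets_pair_measure)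
    show "range (\<lambda>i::nat. space N \<times> space L) \<subseteq> {a \<times> b |a b. a \<in> sets N \<and> b \<in> sets L}" by auto
    show "(\<Union>i::nat. space N \<times> space L) = space N \<times> space L" by auto
    fix i :: nat
    interpret D: prob_space ?\<nu> by (rule prob_space_distr) measurable
    show "emeasure ?\<nu> (space N \<times> space L) \<noteq> \<infinity>" by (simp add: D.emeasure_eq_measure)
  qed
  have "(\<integral>\<^sup>+\<omega>. f (X \<omega>, V \<omega>) \<partial>M) = integral\<^sup>N ?\<nu> f" by (simp add: nn_integral_distr)
  also have "\<dots> = integral\<^sup>N (M \<bind> J) f" by (simp add: \<open>?\<nu> = M \<bind> J\<close>)
  also have "\<dots> = (\<integral>\<^sup>+\<omega>. integral\<^sup>N (J \<omega>) f \<partial>M)" by (rule nn_integral_bind[OF f J])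
  also have "\<dots> = (\<integral>\<^sup>+\<omega>. \<integral>\<^sup>+s. f (X \<omega>, s) \<partial>K (X \<omega>) \<partial>M)"
    unfolding J_def by (intro nn_integral_cong) (simp add: nn_integral_distr[OF pair])
  finally show ?thesis .
qed

lemma integral_measurable_subprob_algebra2:
  fixes f :: "'a \<Rightarrow> 'b \<Rightarrow> real"
  assumes "(\<lambda>(x, y). f x y) \<in> borel_measurable (M \<Otimes>\<^sub>M N)" "L \<in> M \<rightarrow>\<^sub>M subprob_algebra N"
  shows "(\<lambda>x. integral\<^sup>L (L x) (f x)) \<in> borel_measurable M"
proof -
  note assms[measurable] measurable_distr2[measurable]
  have "(\<lambda>x. integral\<^sup>L (distr (L x) (M \<Otimes>\<^sub>M N) (\<lambda>y. (x, y))) (\<lambda>(x, y). f x y)) \<in> borel_measurable M"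
    by measurable
  then show ?thesis
    by (rule measurable_cong[THEN iffD1, rotated])
      (simp add: integral_distr subprob_measurableD(3)[OF assms(2)])
qed

lemma (in prob_space) cond_law_integral:
  fixes f :: "'b \<times> 'c \<Rightarrow> real"
  assumes K: "is_cond_law M N X L V K"
    and X[measurable]: "X \<in> M \<rightarrow>\<^sub>M N" and V[measurable]: "V \<in> M \<rightarrow>\<^sub>M L"
    and f[measurable]: "f \<in> borel_measurable (N \<Otimes>\<^sub>M L)"
    and int: "integrable M (\<lambda>\<omega>. f (X \<omega>, V \<omega>))"
  shows "integrable M (\<lambda>\<omega>. \<integral>s. f (X \<omega>, s) \<partial>K (X \<omega>))"
    and "(\<integral>\<omega>. \<integral>s. f (X \<omega>, s) \<partial>K (X \<omega>) \<partial>M) = (\<integral>\<omega>. f (X \<omega>, V \<omega>) \<partial>M)"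
proof -
  have Ks[measurable]: "K \<in> N \<rightarrow>\<^sub>M subprob_algebra L"
    using K by (auto simp: is_cond_law_def intro: measurable_prob_algebraD)
  have KX[measurable]: "(\<lambda>\<omega>. K (X \<omega>)) \<in> M \<rightarrow>\<^sub>M subprob_algebra L" by measurable
  define P where "P g \<omega> = (\<integral>\<^sup>+s. ennreal (g (X \<omega>, s)) \<partial>K (X \<omega>))" for g :: "'b \<times> 'c \<Rightarrow> real" and \<omega>
  have main: "integrable M (\<lambda>\<omega>. enn2real (P g \<omega>)) \<and> (AE \<omega> in M. P g \<omega> < \<infinity>) \<and>
      (\<integral>\<omega>. enn2real (P g \<omega>) \<partial>M) = enn2real (\<integral>\<^sup>+\<omega>. ennreal (g (X \<omega>, V \<omega>)) \<partial>M)"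
    if g[measurable]: "g \<in> borel_measurable (N \<Otimes>\<^sub>M L)" and ig: "integrable M (\<lambda>\<omega>. g (X \<omega>, V \<omega>))" for g
  proof -
    have [measurable]: "P g \<in> borel_measurable M"
      unfolding P_def by (rule nn_integral_measurable_subprob_algebra2[where N=L]) measurable
    have eq: "(\<integral>\<^sup>+\<omega>. ennreal (g (X \<omega>, V \<omega>)) \<partial>M) = (\<integral>\<^sup>+\<omega>. P g \<omega> \<partial>M)"
      unfolding P_def by (rule cond_law_nn_integral[OF K X V]) measurable
    have "(\<integral>\<^sup>+\<omega>. ennreal (g (X \<omega>, V \<omega>)) \<partial>M) \<noteq> \<infinity>"
      using ig by (auto simp: real_integrable_def)
    then have fin: "(\<integral>\<^sup>+\<omega>. P g \<omega> \<partial>M) < \<infinity>" by (simp add: eq less_top)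
    then have ae: "AE \<omega> in M. P g \<omega> \<noteq> \<infinity>" by (intro nn_integral_PInf_AE) auto
    then have nn: "(\<integral>\<^sup>+\<omega>. ennreal (enn2real (P g \<omega>)) \<partial>M) = (\<integral>\<^sup>+\<omega>. P g \<omega> \<partial>M)"
      by (intro nn_integral_cong_AE) (auto elim!: eventually_mono simp: less_top)
    show ?thesis
      using ae fin
      by (auto simp: integrable_iff_bounded nn eq integral_eq_nn_integral less_top elim!: eventually_mono)
  qed
  have nf: "(\<lambda>x. - f x) \<in> borel_measurable (N \<Otimes>\<^sub>M L)" "integrable M (\<lambda>\<omega>. - f (X \<omega>, V \<omega>))"
    using int by auto
  note p = main[OF f int] and n = main[OF nf]
  have ae: "AE \<omega> in M. (\<integral>s. f (X \<omega>, s) \<partial>K (X \<omega>)) = enn2real (P f \<omega>) - enn2real (P (\<lambda>x. - f x) \<omega>)"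
  proof -
    have "AE \<omega> in M. P f \<omega> < \<infinity> \<and> P (\<lambda>x. - f x) \<omega> < \<infinity>" using p n by auto
    with AE_space show ?thesis
    proof eventually_elim
      case (elim \<omega>)
      have [measurable]: "(\<lambda>s. f (X \<omega>, s)) \<in> borel_measurable (K (X \<omega>))"
        using elim(1) measurable_space[OF X elim(1)] sets_kernel[OF KX elim(1)]
        by (simp cong: measurable_cong_sets)
      have "integrable (K (X \<omega>)) (\<lambda>s. f (X \<omega>, s))"
        using elim by (auto simp: real_integrable_def P_def)
      then show ?case by (simp add: real_lebesgue_integral_def P_def)
    qed
  qed
  have [measurable]: "(\<lambda>\<omega>. \<integral>s. f (X \<omega>, s) \<partial>K (X \<omega>)) \<in> borel_measurable M"
    by (rule integral_measurable_subprob_algebra2[where N=L]) measurable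
  have i: "integrable M (\<lambda>\<omega>. enn2real (P f \<omega>) - enn2real (P (\<lambda>x. - f x) \<omega>))"
    using p n by auto
  then show "integrable M (\<lambda>\<omega>. \<integral>s. f (X \<omega>, s) \<partial>K (X \<omega>))"
    by (subst integrable_cong_AE[OF _ _ ae]) auto
  have "(\<integral>\<omega>. \<integral>s. f (X \<omega>, s) \<partial>K (X \<omega>) \<partial>M) = (\<integral>\<omega>. enn2real (P f \<omega>) - enn2real (P (\<lambda>x. - f x) \<omega>) \<partial>M)"
    using i ae by (intro integral_cong_AE) auto
  also have "\<dots> = (\<integral>\<omega>. f (X \<omega>, V \<omega>) \<partial>M)"
    using p n int by (simp add: real_lebesgue_integral_def)
  finally show "(\<integral>\<omega>. \<integral>s. f (X \<omega>, s) \<partial>K (X \<omega>) \<partial>M) = (\<integral>\<omega>. f (X \<omega>, V \<omega>) \<partial>M)" .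
qed

lemma (in finite_measure) integral_uniform_measure:
  fixes f :: "'a \<Rightarrow> real"
  assumes E[measurable]: "E \<in> sets M" and f[measurable]: "f \<in> borel_measurable M"
  shows "(\<integral>x. f x \<partial>uniform_measure M E) = 1 / measure M E * (\<integral>x. indicator E x * f x \<partial>M)"
proof (cases "measure M E = 0")
  case True
  then have "AE x in M. x \<notin> E"
    by (auto simp: emeasure_eq_measure intro!: AE_not_in null_setsI)
  then have "AE x in uniform_measure M E. f x = 0"
    by (intro AE_uniform_measureI) (auto elim!: eventually_mono)
  then have "(\<integral>x. f x \<partial>uniform_measure M E) = (\<integral>x. 0 \<partial>uniform_measure M E)"
    by (intro integral_cong_AE) auto
  then show ?thesis using True by simp
next
  case False
  then have "measure M E > 0" by (simp add: less_le)
  then have "uniform_measure M E = density M (\<lambda>x. ennreal (indicator E x / measure M E))"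
    unfolding uniform_measure_def
    by (intro density_cong) (auto simp: indicator_def emeasure_eq_measure divide_ennreal[of 1, simplified] intro!: AE_I2)
  then show ?thesis by (simp add: integral_density)
qed

theorem theorem1:
  fixes M :: "'a measure"
    and W :: "'a \<Rightarrow> real ^ 'p"
    and T :: nat
    and t A D :: "'a \<Rightarrow> nat"
    and S :: "'a \<Rightarrow> 's::polish_space" and Sp :: "nat \<Rightarrow> 'a \<Rightarrow> 's"
    and Y :: "'a \<Rightarrow> real" and Yp :: "nat \<Rightarrow> 'a \<Rightarrow> real"
    and c \<eta> :: real
    and Q :: "'s \<times> nat \<times> (real ^ 'p) \<times> nat \<times> nat \<Rightarrow> real"
    and K :: "nat \<times> (real ^ 'p) \<times> nat \<Rightarrow> 's measure"
  assumes "prob_space M"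
    and "W \<in> borel_measurable M"
    and "t \<in> M \<rightarrow>\<^sub>M count_space {1..T}"
    and "A \<in> M \<rightarrow>\<^sub>M count_space {0, 1}"
    and "D \<in> M \<rightarrow>\<^sub>M count_space {0, 1}"
    and "S \<in> borel_measurable M"
    and "Y \<in> borel_measurable M"
    and "\<And>a. a \<in> {0, 1} \<Longrightarrow> Sp a \<in> borel_measurable M"
    and "\<And>a. a \<in> {0, 1} \<Longrightarrow> integrable M (Yp a)"
    and design: "\<And>a. a \<in> {0, 1} \<Longrightarrow> AE \<omega> in M.
        cprob_given M (borel \<Otimes>\<^sub>M count_space {1..T}) (\<lambda>\<omega>. (W \<omega>, t \<omega>)) (\<lambda>\<omega>. A \<omega> = a) \<omega>
          = treat_prob M A t a (t \<omega>)"
    and consistency: "\<And>a. a \<in> {0, 1} \<Longrightarrow> AE \<omega> in M.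
        A \<omega> = a \<longrightarrow> S \<omega> = Sp a \<omega> \<and> Y \<omega> = Yp a \<omega>"
    and sequential_randomization:
      "cond_indep M
        (borel \<Otimes>\<^sub>M borel \<Otimes>\<^sub>M borel \<Otimes>\<^sub>M borel) (\<lambda>\<omega>. (Yp 0 \<omega>, Yp 1 \<omega>, Sp 0 \<omega>, Sp 1 \<omega>))
        (count_space {0, 1}) A
        (borel \<Otimes>\<^sub>M count_space {1..T}) (\<lambda>\<omega>. (W \<omega>, t \<omega>))"
    and surrogate_MAR: "AE \<omega> in M.
        cprob_given M (borel \<Otimes>\<^sub>M borel \<Otimes>\<^sub>M count_space {0, 1} \<Otimes>\<^sub>M borel \<Otimes>\<^sub>M count_space {1..T})
          (\<lambda>\<omega>. (Y \<omega>, S \<omega>, A \<omega>, W \<omega>, t \<omega>)) (\<lambda>\<omega>. D \<omega> = 1) \<omega>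
        = cprob_given M (borel \<Otimes>\<^sub>M count_space {0, 1} \<Otimes>\<^sub>M borel \<Otimes>\<^sub>M count_space {1..T})
          (\<lambda>\<omega>. (S \<omega>, A \<omega>, W \<omega>, t \<omega>)) (\<lambda>\<omega>. D \<omega> = 1) \<omega>"
    and "c > 0"
    and support_positivity: "AE \<omega> in M. t \<omega> \<in> overlap M A t \<longrightarrow>
        c \<le> cprob_given M (borel \<Otimes>\<^sub>M count_space {0, 1} \<Otimes>\<^sub>M borel \<Otimes>\<^sub>M count_space {1..T})
          (\<lambda>\<omega>. (S \<omega>, A \<omega>, W \<omega>, t \<omega>)) (\<lambda>\<omega>. D \<omega> = 1) \<omega>"
    and "\<eta> > 0"
    and treatment_overlap: "\<And>k. k \<in> overlap M A t \<Longrightarrow>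
        \<eta> \<le> treat_prob M A t 1 k \<and> treat_prob M A t 1 k \<le> 1 - \<eta>"
    \<comment> \<open>\<open>Q (s, a, w, k, d) = E[Y | S = s, A = a, W = w, t = k, \<Delta> = d]\<close>, any version\<close>
    and Q: "is_regression M
        (borel \<Otimes>\<^sub>M count_space {0, 1} \<Otimes>\<^sub>M borel \<Otimes>\<^sub>M count_space {1..T} \<Otimes>\<^sub>M count_space {0, 1})
        (\<lambda>\<omega>. (S \<omega>, A \<omega>, W \<omega>, t \<omega>, D \<omega>)) Y Q"
    \<comment> \<open>\<open>K (a, w, k) = Law(S | A = a, W = w, t = k)\<close>, any version\<close>
    and K: "is_cond_law M (count_space {0, 1} \<Otimes>\<^sub>M borel \<Otimes>\<^sub>M count_space {1..T})
        (\<lambda>\<omega>. (A \<omega>, W \<omega>, t \<omega>)) borel S K"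
  shows "overlap_ate M A t Yp =
    1 / measure M {\<omega> \<in> space M. t \<omega> \<in> overlap M A t} *
    (\<integral>(w, k). indicator (overlap M A t) k *
        ((\<integral>s. Q (s, 1, w, k, 1) \<partial>K (1, w, k)) - (\<integral>s. Q (s, 0, w, k, 1) \<partial>K (0, w, k)))
      \<partial>distr M (borel \<Otimes>\<^sub>M count_space {1..T}) (\<lambda>\<omega>. (W \<omega>, t \<omega>)))"
proof -
  interpret prob_space M by fact
  note [measurable] = assms(2-8)
  have iYp: "integrable M (Yp a)" if "a \<in> {0, 1}" for a using assms(9) that .
  have [measurable]: "Sp 0 \<in> borel_measurable M" "Sp 1 \<in> borel_measurable M"
    "Yp 0 \<in> borel_measurable M" "Yp 1 \<in> borel_measurable M"
    using assms(8) iYp by auto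
  have A01: "A \<omega> \<in> {0, 1}" if "\<omega> \<in> space M" for \<omega>
    using measurable_space[OF \<open>A \<in> M \<rightarrow>\<^sub>M count_space {0, 1}\<close> that] by simp
  let ?cT = "count_space {1..T}" and ?c2 = "count_space {0, 1 :: nat}"
  let ?NV = "(borel :: (real ^ 'p) measure) \<Otimes>\<^sub>M ?cT" and ?V = "\<lambda>\<omega>. (W \<omega>, t \<omega>)"
  let ?NX = "?c2 \<Otimes>\<^sub>M ?NV" and ?X = "\<lambda>\<omega>. (A \<omega>, W \<omega>, t \<omega>)"
  let ?NZ = "(borel :: 's measure) \<Otimes>\<^sub>M ?NX" and ?Z = "\<lambda>\<omega>. (S \<omega>, A \<omega>, W \<omega>, t \<omega>)"
  let ?NG = "(borel :: real measure) \<Otimes>\<^sub>M ?NZ" and ?ZG = "\<lambda>\<omega>. (Y \<omega>, S \<omega>, A \<omega>, W \<omega>, t \<omega>)"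
  let ?NH = "(borel :: 's measure) \<Otimes>\<^sub>M ?c2 \<Otimes>\<^sub>M borel \<Otimes>\<^sub>M ?cT \<Otimes>\<^sub>M ?c2"
    and ?ZH = "\<lambda>\<omega>. (S \<omega>, A \<omega>, W \<omega>, t \<omega>, D \<omega>)"
  have V: "?V \<in> M \<rightarrow>\<^sub>M ?NV" and X: "?X \<in> M \<rightarrow>\<^sub>M ?NX" and Z: "?Z \<in> M \<rightarrow>\<^sub>M ?NZ"
    and ZG: "?ZG \<in> M \<rightarrow>\<^sub>M ?NG" and ZH: "?ZH \<in> M \<rightarrow>\<^sub>M ?NH"
    by measurable
  define FV where "FV = vimage_algebra (space M) ?V ?NV"
  define FZ where "FZ = vimage_algebra (space M) ?Z ?NZ"
  define FG where "FG = vimage_algebra (space M) ?ZG ?NG"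
  define FH where "FH = vimage_algebra (space M) ?ZH ?NH"
  note F_defs = FV_def FZ_def FG_def FH_def
  have subM: "subalgebra M FV" "subalgebra M FZ" "subalgebra M FG" "subalgebra M FH"
    unfolding F_defs by (rule subalgebra_vimage_algebra[OF V] subalgebra_vimage_algebra[OF Z]
        subalgebra_vimage_algebra[OF ZG] subalgebra_vimage_algebra[OF ZH])+
  have subG: "subalgebra FG FZ"
    using subalgebra_vimage_algebra_comp[OF ZG, of snd ?NZ] by (simp add: F_defs)
  have "(\<lambda>z. (fst z, fst (snd z), fst (snd (snd z)), fst (snd (snd (snd z))))) \<in> ?NH \<rightarrow>\<^sub>M ?NZ"
    by measurable
  from subalgebra_vimage_algebra_comp[OF ZH this] have subH: "subalgebra FH FZ"
    by (simp add: F_defs)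
  interpret FV: sigma_finite_subalgebra M FV by (rule sigma_finite_subalgebraI[OF subM(1)])

  define Ov where "Ov = overlap M A t"
  define g where "g = treat_prob M A t"
  define v where "v a k = indicator Ov k / g a k" for a k
  define h where "h a x = (\<integral>s. Q (s, a, fst x, snd x, 1) \<partial>K (a, x))" for a x

  have g_ge: "\<eta> \<le> g a k" if "a \<in> {0, 1}" "k \<in> Ov" for a k
  proof (cases "a = 1")
    case False
    let ?P = "\<lambda>b. prob {\<omega>\<in>space M. A \<omega> = b \<and> t \<omega> = k}"
    have pos: "0 < g 1 k" using that by (simp add: Ov_def g_def overlap_def)
    have "{\<omega>\<in>space M. t \<omega> = k} = {\<omega>\<in>space M. A \<omega> = 0 \<and> t \<omega> = k} \<union> {\<omega>\<in>space M. A \<omega> = 1 \<and> t \<omega> = k}"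
      using A01 by auto
    then have "prob {\<omega>\<in>space M. t \<omega> = k} = ?P 0 + ?P 1"
      by (simp, subst finite_measure_Union) auto
    moreover have "prob {\<omega>\<in>space M. t \<omega> = k} \<noteq> 0"
      using pos by (auto simp: g_def treat_prob_def cond_prob_def)
    ultimately have "g 0 k = 1 - g 1 k"
      by (simp add: g_def treat_prob_def cond_prob_def diff_divide_distrib[symmetric] eq_divide_eq divide_eq_eq
        field_simps)
    then show ?thesis using treatment_overlap[of k] that False by (auto simp: g_def Ov_def)
  qed (use treatment_overlap[of k] that in \<open>auto simp: g_def Ov_def\<close>)
  have v0: "0 \<le> v a k" and vb: "v a k \<le> 1 / \<eta>" and vg: "v a k * g a k = indicator Ov k"
    and v_nz: "v a k \<noteq> 0 \<longrightarrow> k \<in> Ov"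
    if "a \<in> {0, 1}" for a k
    using g_ge[OF that, of k] \<open>\<eta> > 0\<close> by (auto simp: v_def indicator_def intro!: frac_le)
  have [measurable]: "v a \<in> borel_measurable ?cT" for a by simp
  have Ov[measurable]: "(\<lambda>\<omega>. indicator Ov (t \<omega>) :: real) \<in> borel_measurable M"
    by (rule measurable_compose[OF \<open>t \<in> M \<rightarrow>\<^sub>M ?cT\<close>]) simp

  have iY: "integrable M Y"
  proof -
    have "AE \<omega> in M. indicator {1} (A \<omega>) * Yp 1 \<omega> + indicator {0} (A \<omega>) * Yp 0 \<omega> = Y \<omega>"
      using consistency[of 0, simplified] consistency[of 1, simplified] AE_space
      by eventually_elim (use A01 in \<open>force simp: indicator_def\<close>)
    moreover have "integrable M (\<lambda>\<omega>. indicator {1} (A \<omega>) * Yp 1 \<omega> + indicator {0} (A \<omega>) * Yp 0 \<omega>)"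
      by (intro Bochner_Integration.integrable_add integrable_bounded_mult[where b=1] iYp)
        (auto simp: indicator_def simp del: One_nat_def)
    ultimately show ?thesis by (subst integrable_cong_AE[symmetric]) auto
  qed
  have [measurable]: "Q \<in> borel_measurable ?NH" using Q by (simp add: is_regression_def)
  have [measurable]: "K \<in> ?NX \<rightarrow>\<^sub>M subprob_algebra borel"
    using K by (auto simp: is_cond_law_def intro: measurable_prob_algebraD)

  have arm: "integrable M (\<lambda>\<omega>. indicator Ov (t \<omega>) * h a (?V \<omega>)) \<and>
      (\<integral>\<omega>. indicator Ov (t \<omega>) * h a (?V \<omega>) \<partial>M) = (\<integral>\<omega>. indicator Ov (t \<omega>) * Yp a \<omega> \<partial>M)"
    and h_meas: "h a \<in> borel_measurable ?NV"
    if a: "a \<in> {0, 1}" for a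
  proof -
    have [measurable]: "a \<in> space ?c2" "1 \<in> space ?c2" using a by auto
    have Ypa[measurable]: "Yp a \<in> borel_measurable M" using iYp[OF a] by simp
    have a_sets[measurable]: "{a} \<in> sets ?c2" using a by auto
    have des: "AE \<omega> in M. cprob_given M ?NV ?V (\<lambda>\<omega>. A \<omega> \<in> {a}) \<omega> = g a (t \<omega>)"
      using design[OF a] by (simp add: g_def)
    show h[measurable]: "h a \<in> borel_measurable ?NV"
      unfolding h_def by (rule integral_measurable_subprob_algebra2[where N=borel]) measurable
    define \<psi> where "\<psi> \<omega> = v a (t \<omega>) * indicator {a} (A \<omega>)" for \<omega>
    have \<psi>M[measurable]: "\<psi> \<in> borel_measurable M" unfolding \<psi>_def by measurable

    have "(\<integral>\<omega>. \<psi> \<omega> * Yp a \<omega> \<partial>M) =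
        (\<integral>\<omega>. v a (t \<omega>) * cprob_given M ?NV ?V (\<lambda>\<omega>. A \<omega> \<in> {a}) \<omega> * Yp a \<omega> \<partial>M)"
    proof -
      have vF: "(\<lambda>\<omega>. v a (t \<omega>)) \<in> borel_measurable (vimage_algebra (space M) ?V ?NV)"
      proof -
        have "(\<lambda>x. v a (snd x)) \<in> borel_measurable ?NV" by measurable
        from measurable_vimage_algebra_comp[OF V this] show ?thesis by simp
      qed
      have U: "(\<lambda>\<omega>. (Yp 0 \<omega>, Yp 1 \<omega>, Sp 0 \<omega>, Sp 1 \<omega>)) \<in> M \<rightarrow>\<^sub>M borel \<Otimes>\<^sub>M borel \<Otimes>\<^sub>M borel \<Otimes>\<^sub>M borel"
        by measurable
      have f: "(\<lambda>u. if a = 0 then fst u else fst (snd u)) \<in>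
          borel_measurable (borel \<Otimes>\<^sub>M borel \<Otimes>\<^sub>M (borel :: 's measure) \<Otimes>\<^sub>M (borel :: 's measure))"
        by measurable
      have Yp_eq: "(if a = 0 then fst (Yp 0 \<omega>, Yp 1 \<omega>, Sp 0 \<omega>, Sp 1 \<omega>)
          else fst (snd (Yp 0 \<omega>, Yp 1 \<omega>, Sp 0 \<omega>, Sp 1 \<omega>))) = Yp a \<omega>" for \<omega>
        using a by auto
      show ?thesis
        using cond_indep_integral[OF sequential_randomization U \<open>A \<in> M \<rightarrow>\<^sub>M ?c2\<close> V a_sets f vF
            v0[OF a] vb[OF a]]
        unfolding \<psi>_def Yp_eq .
    qed
    also have "\<dots> = (\<integral>\<omega>. indicator Ov (t \<omega>) * Yp a \<omega> \<partial>M)"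
    proof (rule integral_cong_AE)
      show "AE \<omega> in M. v a (t \<omega>) * cprob_given M ?NV ?V (\<lambda>\<omega>. A \<omega> \<in> {a}) \<omega> * Yp a \<omega> = indicator Ov (t \<omega>) * Yp a \<omega>"
        using des by eventually_elim (simp add: vg[OF a])
    qed (simp_all add: cprob_given_def cexp_given_def)
    finally have step_random: "(\<integral>\<omega>. \<psi> \<omega> * Yp a \<omega> \<partial>M) = (\<integral>\<omega>. indicator Ov (t \<omega>) * Yp a \<omega> \<partial>M)" .

    have step_consist: "(\<integral>\<omega>. \<psi> \<omega> * Y \<omega> \<partial>M) = (\<integral>\<omega>. \<psi> \<omega> * Yp a \<omega> \<partial>M)"
    proof (rule integral_cong_AE)
      show "AE \<omega> in M. \<psi> \<omega> * Y \<omega> = \<psi> \<omega> * Yp a \<omega>"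
        using consistency[OF a] by eventually_elim (auto simp: \<psi>_def indicator_def)
    qed auto

    let ?q1 = "\<lambda>\<omega>. Q (S \<omega>, A \<omega>, W \<omega>, t \<omega>, 1)"
    let ?D = "{\<omega>\<in>space M. D \<omega> = 1}"
    have "integrable M (\<lambda>\<omega>. \<psi> \<omega> * ?q1 \<omega>) \<and> (\<integral>\<omega>. \<psi> \<omega> * ?q1 \<omega> \<partial>M) = (\<integral>\<omega>. \<psi> \<omega> * Y \<omega> \<partial>M)"
    proof -
      have DH: "?D \<in> sets FH"
      proof -
        have "(\<lambda>z. snd (snd (snd (snd z)))) \<in> ?NH \<rightarrow>\<^sub>M ?c2" by measurable
        from measurable_vimage_algebra_comp[OF ZH this] have [measurable]: "D \<in> FH \<rightarrow>\<^sub>M ?c2"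
          by (simp add: F_defs)
        have "{\<omega>\<in>space FH. D \<omega> = 1} \<in> sets FH" by measurable
        then show ?thesis by (simp add: FH_def)
      qed
      have YG: "Y \<in> borel_measurable FG"
        using measurable_vimage_algebra_comp[OF ZG measurable_fst] by (simp add: FG_def)
      have q1F: "?q1 \<in> borel_measurable FZ"
      proof -
        have "(\<lambda>z. Q (fst z, fst (snd z), fst (snd (snd z)), snd (snd (snd z)), 1)) \<in> borel_measurable ?NZ"
          by measurable
        from measurable_vimage_algebra_comp[OF Z this] show ?thesis by (simp add: FZ_def)
      qed
      have \<psi>F: "\<psi> \<in> borel_measurable FZ"
      proof -
        have "(\<lambda>z. v a (snd (snd (snd z))) * indicator {a} (fst (snd z))) \<in> borel_measurable ?NZ"
          by measurable
        from measurable_vimage_algebra_comp[OF Z this] show ?thesis by (simp add: FZ_def \<psi>_def[abs_def])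
      qed
      have MAR: "AE \<omega> in M. real_cond_exp M FG (indicator ?D) \<omega> = real_cond_exp M FZ (indicator ?D) \<omega>"
        using surrogate_MAR by (simp add: cprob_given_def cexp_given_def F_defs)
      have q1: "AE \<omega> in M. \<omega> \<in> ?D \<longrightarrow> ?q1 \<omega> = real_cond_exp M FH Y \<omega>"
        using Q unfolding is_regression_def cexp_given_def FH_def[symmetric] by (auto elim!: eventually_mono)
      have \<psi>b: "AE \<omega> in M. \<bar>\<psi> \<omega>\<bar> \<le> 1 / \<eta>"
        using v0[OF a] vb[OF a] \<open>\<eta> > 0\<close> by (auto simp: \<psi>_def indicator_def)
      have pos: "AE \<omega> in M. \<psi> \<omega> \<noteq> 0 \<longrightarrow> c \<le> real_cond_exp M FZ (indicator ?D) \<omega>"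
        using support_positivity unfolding cprob_given_def cexp_given_def FZ_def[symmetric] Ov_def[symmetric]
        by eventually_elim (use v_nz[OF a] in \<open>auto simp: \<psi>_def\<close>)
      show ?thesis
        using missing_at_random_integral[OF subG subH subM(3,4) DH YG iY MAR q1F q1 \<psi>F \<psi>b \<open>c > 0\<close> pos]
        by simp
    qed
    then have iq1: "integrable M (\<lambda>\<omega>. \<psi> \<omega> * ?q1 \<omega>)"
      and step_MAR: "(\<integral>\<omega>. \<psi> \<omega> * ?q1 \<omega> \<partial>M) = (\<integral>\<omega>. \<psi> \<omega> * Y \<omega> \<partial>M)" by auto

    let ?f = "\<lambda>y. v a (snd (snd (fst y))) * indicator {a} (fst (fst y)) *
      Q (snd y, fst (fst y), fst (snd (fst y)), snd (snd (fst y)), 1)"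
    have f: "?f \<in> borel_measurable (?NX \<Otimes>\<^sub>M borel)" by measurable
    have f_eq: "(\<integral>s. ?f (?X \<omega>, s) \<partial>K (?X \<omega>)) = v a (t \<omega>) * h a (?V \<omega>) * indicator {\<omega>\<in>space M. A \<omega> \<in> {a}} \<omega>"
      if "\<omega> \<in> space M" for \<omega>
      using that by (simp add: h_def indicator_def)
    have "integrable M (\<lambda>\<omega>. ?f (?X \<omega>, S \<omega>))" using iq1 by (simp add: \<psi>_def)
    note dis = cond_law_integral[OF K X \<open>S \<in> borel_measurable M\<close> f this]
    have ih: "integrable M (\<lambda>\<omega>. v a (t \<omega>) * h a (?V \<omega>) * indicator {\<omega>\<in>space M. A \<omega> \<in> {a}} \<omega>)"
      using dis(1) by (subst (asm) Bochner_Integration.integrable_cong[OF refl f_eq])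
    have step_dis: "(\<integral>\<omega>. v a (t \<omega>) * h a (?V \<omega>) * indicator {\<omega>\<in>space M. A \<omega> \<in> {a}} \<omega> \<partial>M) = (\<integral>\<omega>. \<psi> \<omega> * ?q1 \<omega> \<partial>M)"
      using dis(2) by (subst (asm) Bochner_Integration.integral_cong[OF refl f_eq]) (simp_all add: \<psi>_def)

    have "(\<lambda>x. v a (snd x) * h a x) \<in> borel_measurable ?NV" by measurable
    from measurable_vimage_algebra_comp[OF V this]
    have vhF: "(\<lambda>\<omega>. v a (t \<omega>) * h a (?V \<omega>)) \<in> borel_measurable FV" by (simp add: FV_def)
    have "(indicator {\<omega>\<in>space M. A \<omega> \<in> {a}} :: 'a \<Rightarrow> real) \<in> borel_measurable M" by measurable
    note ce = FV.real_cond_exp_intg[OF ih vhF this]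
    have ce_eq: "AE \<omega> in M. v a (t \<omega>) * h a (?V \<omega>) * real_cond_exp M FV (indicator {\<omega>\<in>space M. A \<omega> \<in> {a}}) \<omega> =
        indicator Ov (t \<omega>) * h a (?V \<omega>)"
      using des unfolding cprob_given_def cexp_given_def FV_def[symmetric]
      by eventually_elim (simp add: vg[OF a, symmetric])
    have [measurable]: "(\<lambda>\<omega>. h a (?V \<omega>)) \<in> borel_measurable M"
      using measurable_compose[OF V h] .
    have "integrable M (\<lambda>\<omega>. indicator Ov (t \<omega>) * h a (?V \<omega>))"
      by (subst integrable_cong_AE[OF _ _ ce_eq, symmetric]) (use ce in auto)
    moreover have "(\<integral>\<omega>. indicator Ov (t \<omega>) * h a (?V \<omega>) \<partial>M) = (\<integral>\<omega>. indicator Ov (t \<omega>) * Yp a \<omega> \<partial>M)"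
    proof -
      have "(\<integral>\<omega>. indicator Ov (t \<omega>) * h a (?V \<omega>) \<partial>M) =
          (\<integral>\<omega>. v a (t \<omega>) * h a (?V \<omega>) * real_cond_exp M FV (indicator {\<omega>\<in>space M. A \<omega> \<in> {a}}) \<omega> \<partial>M)"
        by (rule integral_cong_AE) (use ce_eq ce in \<open>auto elim: eventually_mono\<close>)
      then show ?thesis by (simp only: ce(2) step_dis step_MAR step_consist step_random)
    qed
    ultimately show "integrable M (\<lambda>\<omega>. indicator Ov (t \<omega>) * h a (?V \<omega>)) \<and>
      (\<integral>\<omega>. indicator Ov (t \<omega>) * h a (?V \<omega>) \<partial>M) = (\<integral>\<omega>. indicator Ov (t \<omega>) * Yp a \<omega> \<partial>M)" by simp
  qed

  let ?E = "{\<omega> \<in> space M. t \<omega> \<in> Ov}"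
  have [measurable]: "Measurable.pred M (\<lambda>\<omega>. t \<omega> \<in> Ov)"
    by (rule measurable_compose[OF \<open>t \<in> M \<rightarrow>\<^sub>M ?cT\<close>]) simp
  have [measurable]: "?E \<in> sets M" by measurable
  have [measurable]: "h 0 \<in> borel_measurable ?NV" "h 1 \<in> borel_measurable ?NV" using h_meas by auto
  have iOv: "integrable M (\<lambda>\<omega>. indicator Ov (t \<omega>) * Yp a \<omega>)" if "a \<in> {0, 1}" for a
    by (rule integrable_bounded_mult[OF iYp[OF that], where b=1]) (auto simp: indicator_def)
  have "overlap_ate M A t Yp = 1 / measure M ?E * (\<integral>\<omega>. indicator ?E \<omega> * (Yp 1 \<omega> - Yp 0 \<omega>) \<partial>M)"
    unfolding overlap_ate_def Ov_def[symmetric] by (rule integral_uniform_measure) measurable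
  also have "(\<integral>\<omega>. indicator ?E \<omega> * (Yp 1 \<omega> - Yp 0 \<omega>) \<partial>M) =
      (\<integral>\<omega>. indicator Ov (t \<omega>) * Yp 1 \<omega> - indicator Ov (t \<omega>) * Yp 0 \<omega> \<partial>M)"
    by (intro Bochner_Integration.integral_cong) (auto simp: indicator_def)
  also have "\<dots> = (\<integral>\<omega>. indicator Ov (t \<omega>) * h 1 (?V \<omega>) - indicator Ov (t \<omega>) * h 0 (?V \<omega>) \<partial>M)"
    using arm[of 0] arm[of 1] iOv[of 0] iOv[of 1] by simp
  also have "\<dots> = (\<integral>x. indicator Ov (snd x) * (h 1 x - h 0 x) \<partial>distr M ?NV ?V)"
  proof -
    have [measurable]: "(\<lambda>x. indicator Ov (snd x) :: real) \<in> borel_measurable ?NV"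
      by (rule measurable_compose[OF measurable_snd]) simp
    have "(\<lambda>x. indicator Ov (snd x) * (h 1 x - h 0 x)) \<in> borel_measurable ?NV" by measurable
    from integral_distr[OF V this] show ?thesis by (simp add: right_diff_distrib)
  qed
  finally show ?thesis by (simp add: h_def Ov_def case_prod_beta')
qed

end
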